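(* Let $d>0$ and consider the linear-search problem with turn cost $d$. The search strategy $x_i = d(2^i-1)/2$, $i=1,2,3,\ldots$, finds every target at cost at most $9\,\mathrm{OPT}+2d$, where $\mathrm{OPT}>0$ is the distance of the target from the origin. Moreover, the additive term $2d$ is minimal subject to the competitive ratio $9$: if $B$ is a real number and $(x_i)_{i\ge 1}$ is any search strategy that finds every target (at every distance $\mathrm{OPT}>0$, on either side) at cost at most $9\,\mathrm{OPT}+B$, then $B\ge 2d$.
   Context: Linear-search problem with turn cost $d>0$: an immobile target is hidden on the real line at an unknown point at distance $\mathrm{OPT}>0$ from the origin. The searcher starts at the origin and notices the target only when she reaches its position. A search strategy is a sequence $x_1,x_2,x_3,\ldots$ of positive reals with $x_{i+2}>x_i$ for all $i$. The searcher starts at the origin, goes right to $+x_1$, turns, goes left to $-x_2$, turns, goes right to $+x_3$, and so on; that is, the $i$-th turning point is $p_i=(-1)^{i+1}x_i$. Her cost until she finds the target is the total distance traveled plus $d$ for each change of direction. Explicitly, let the target be at distance $t>0$ from the origin, and let $k$ be the least index such that $p_k$ lies on the target's side of the origin and $x_k\ge t$. Then the cost is $2\sum_{i=1}^{k-1}x_i+(k-1)d+t$ (and it is $+\infty$ if no such $k$ exists). The number $9$ is the optimal (smallest possible) competitive ratio of the linear-search problem without turn cost. *)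

theory Defs
  imports Complex_Main "HOL-Library.Extended_Real"
begin

text \<open>
  A strategy is a sequence \<open>x :: nat \<Rightarrow> real\<close> indexed from 1; the value \<open>x 0\<close> is never used.
\<close>

definition search_strategy :: "(nat \<Rightarrow> real) \<Rightarrow> bool" where
  "search_strategy x \<longleftrightarrow> (\<forall>i\<ge>1. x i > 0) \<and> (\<forall>i\<ge>1. x (i + 2) > x i)"

definition turning_point :: "(nat \<Rightarrow> real) \<Rightarrow> nat \<Rightarrow> real" where
  "turning_point x i = (-1) ^ (i + 1) * x i"

text \<open>
  A target is given by its signed position \<open>z \<noteq> 0\<close>, so its distance from the origin is \<open>\<bar>z\<bar>\<close>
  and its side is \<open>sgn z\<close>.
\<close>

definition reaches :: "(nat \<Rightarrow> real) \<Rightarrow> real \<Rightarrow> nat \<Rightarrow> bool" where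
  "reaches x z k \<longleftrightarrow> k \<ge> 1 \<and> sgn (turning_point x k) = sgn z \<and> x k \<ge> \<bar>z\<bar>"

definition search_cost :: "real \<Rightarrow> (nat \<Rightarrow> real) \<Rightarrow> real \<Rightarrow> ereal" where
  "search_cost d x z =
     (if \<exists>k. reaches x z k
      then let k = (LEAST k. reaches x z k)
           in ereal (2 * (\<Sum>i = 1..<k. x i) + (real k - 1) * d + \<bar>z\<bar>)
      else \<infinity>)"

definition finds_all_within :: "real \<Rightarrow> (nat \<Rightarrow> real) \<Rightarrow> real \<Rightarrow> real \<Rightarrow> bool" where
  "finds_all_within d x c B \<longleftrightarrow> (\<forall>z. z \<noteq> 0 \<longrightarrow> search_cost d x z \<le> ereal (c * \<bar>z\<bar> + B))"

end

theory Submission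
  imports Defs
begin

text \<open>
  Upper bound: the cost of a target first reached at turn \<open>k\<close> is \<open>d * (2 ^ k - 2) + \<bar>z\<bar>\<close>,
  and for \<open>k > 2\<close> \<open>\<bar>z\<bar>\<close> exceeds the turning point \<open>x (k - 2)\<close>, which gives \<open>8 * \<bar>z\<bar> > d * (2 ^ k - 4)\<close>.

  Lower bound: targets placed just beyond \<open>x n\<close> (just beyond the origin for \<open>n = 0\<close>) force
  \<open>2 * (x 1 + \<dots> + x (n + 1)) + (n + 1) * d \<le> 8 * x n + B\<close>. For the partial sums, the homogeneous
  part is the recurrence \<open>S (n + 1) = 4 * (S n - S (n - 1))\<close> with double root 2. Subtracting an
  affine particular solution and dividing by \<open>2 ^ n\<close> turns the inequality into concavity of a
  sequence that is eventually positive. Hence its first increment is nonnegative,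
  which says precisely \<open>B \<ge> 2 * d\<close>.
\<close>

text \<open>Increments never grow, so a negative first one would keep \<open>V\<close> below a line
  of negative slope and make it negative eventually.\<close>

lemma concave_eventually_nonneg_imp_increment_nonneg:
  fixes V :: "nat \<Rightarrow> real"
  assumes concave: "\<And>n. V (n + 2) - V (n + 1) \<le> V (n + 1) - V n"
    and nonneg: "\<And>n. n \<ge> N \<Longrightarrow> V n \<ge> 0"
  shows "V 0 \<le> V 1"
proof (rule ccontr)
  assume "\<not> V 0 \<le> V 1"
  then have neg: "V 1 - V 0 < 0" by simp
  have incr: "V (Suc n) - V n \<le> V 1 - V 0" for n
  proof (induction n)
    case (Suc n)
    then show ?case using concave[of n] by simp
  qed simp
  have bound: "V n \<le> V 0 + real n * (V 1 - V 0)" for n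
  proof (induction n)
    case (Suc n)
    then show ?case using incr[of n] by (simp add: algebra_simps)
  qed simp
  obtain m where m: "V 0 < real m * (V 0 - V 1)"
    using reals_Archimedean3[of "V 0 - V 1"] neg by auto
  have "V (max m N) \<le> V 0 - real (max m N) * (V 0 - V 1)"
    using bound[of "max m N"] by (simp add: algebra_simps)
  also have "\<dots> \<le> V 0 - real m * (V 0 - V 1)"
    using neg by (intro diff_left_mono mult_right_mono) auto
  also have "\<dots> < 0" using m by simp
  finally show False using nonneg[of "max m N"] by simp
qed

lemma search_strategy_pos: "search_strategy x \<Longrightarrow> i \<ge> 1 \<Longrightarrow> x i > 0"
  by (simp add: search_strategy_def)

lemma search_strategy_mono_same_parity:
  assumes "search_strategy x" "i \<ge> 1"
  shows "x i \<le> x (i + 2 * m)"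
proof (induction m)
  case (Suc m)
  have "x (i + 2 * m) < x (i + 2 * m + 2)"
    using assms by (simp add: search_strategy_def)
  with Suc show ?case by simp
qed simp

lemma reaches_iff:
  assumes "search_strategy x" "k \<ge> 1"
  shows "reaches x z k \<longleftrightarrow> sgn z = (-1) ^ (k + 1) \<and> \<bar>z\<bar> \<le> x k"
  using assms search_strategy_pos[OF assms]
  by (auto simp: reaches_def turning_point_def sgn_mult)

text \<open>Distance already explored on the side of turn \<open>k\<close> by earlier turns. For the
  first turn on each side this is \<open>0\<close>, since \<open>k - 2\<close> would there point to
  the meaningless \<open>x 0\<close>.\<close>

definition last_on_side :: "(nat \<Rightarrow> real) \<Rightarrow> nat \<Rightarrow> real" where
  "last_on_side x k = (if k \<le> 2 then 0 else x (k - 2))"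

lemma last_on_side_nonneg: "search_strategy x \<Longrightarrow> last_on_side x k \<ge> 0"
  using search_strategy_pos[of x "k - 2"] by (auto simp: last_on_side_def less_imp_le)

lemma last_on_side_less: "search_strategy x \<Longrightarrow> k \<ge> 1 \<Longrightarrow> last_on_side x k < x k"
proof (cases "k \<le> 2")
  case False
  assume "search_strategy x"
  moreover have "k - 2 \<ge> 1" "k = (k - 2) + 2" using False by auto
  ultimately have "x (k - 2) < x k" unfolding search_strategy_def by metis
  then show ?thesis using False by (simp add: last_on_side_def)
qed (simp add: last_on_side_def search_strategy_pos)

text \<open>Any earlier turn on the same side has index \<open>k - 2\<close> minus an even number,
  so it goes no farther than \<open>x (k - 2)\<close> and misses \<open>z\<close>.\<close>

lemma Least_reaches:
  assumes x: "search_strategy x" and "k \<ge> 1"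
    and sgn: "sgn z = (-1) ^ (k + 1)" and z: "last_on_side x k < \<bar>z\<bar>" "\<bar>z\<bar> \<le> x k"
  shows "(LEAST j. reaches x z j) = k"
proof (rule Least_equality)
  show "reaches x z k" using assms by (simp add: reaches_iff)
  fix j assume j: "reaches x z j"
  then have "j \<ge> 1" by (simp add: reaches_def)
  show "k \<le> j"
  proof (rule ccontr)
    assume "\<not> k \<le> j"
    have "(-1::real) ^ (j + 1) = (-1) ^ (k + 1)" and zj: "\<bar>z\<bar> \<le> x j"
      using j sgn reaches_iff[OF x \<open>j \<ge> 1\<close>] by auto
    then have "even j = even k"
      by (cases "even j"; cases "even k") auto
    with \<open>\<not> k \<le> j\<close> have "even (k - j)" "k - j > 0" by auto
    then obtain m where "k - j = 2 * m" "m > 0" by (metis dvdE mult_0_right neq0_conv)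
    then have m: "k - 2 = j + 2 * (m - 1)" "\<not> k \<le> 2"
      using \<open>j \<ge> 1\<close> \<open>\<not> k \<le> j\<close> by auto
    have "x j \<le> x (k - 2)"
      unfolding m(1) by (rule search_strategy_mono_same_parity[OF x \<open>j \<ge> 1\<close>])
    then show False using z zj m by (simp add: last_on_side_def)
  qed
qed

lemma search_cost_eq:
  assumes "search_strategy x" "k \<ge> 1"
    and "sgn z = (-1) ^ (k + 1)" "last_on_side x k < \<bar>z\<bar>" "\<bar>z\<bar> \<le> x k"
  shows "search_cost d x z = ereal (2 * (\<Sum>i = 1..<k. x i) + (real k - 1) * d + \<bar>z\<bar>)"
proof -
  have "reaches x z k" using assms by (simp add: reaches_iff)
  then show ?thesis
    using Least_reaches[OF assms] by (auto simp: search_cost_def)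
qed

text \<open>Converse of \<open>Least_reaches\<close>: turn \<open>k - 2\<close> is on the side of
  \<open>z\<close>, so by minimality of \<open>k\<close> it must fall short.\<close>

lemma last_on_side_less_if_Least_reaches:
  assumes x: "search_strategy x" and "z \<noteq> 0"
    and k: "k = (LEAST j. reaches x z j)" and reach: "reaches x z k"
  shows "last_on_side x k < \<bar>z\<bar>"
proof (cases "k \<le> 2")
  case False
  then have "k - 2 \<ge> 1" by simp
  have "\<not> reaches x z (k - 2)"
    using not_less_Least[of "k - 2" "reaches x z"] False k by simp
  moreover have "(-1::real) ^ (k - 2 + 1) = (-1) ^ (k + 1)"
    using False by (cases "even k") auto
  ultimately show ?thesis
    using reach reaches_iff[OF x \<open>k - 2 \<ge> 1\<close>, of z] reaches_iff[OF x, of k z] False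
    by (auto simp: last_on_side_def)
qed (use \<open>z \<noteq> 0\<close> in \<open>simp add: last_on_side_def\<close>)

lemma finds_all_within_turning_point_bound:
  assumes x: "search_strategy x" and f: "finds_all_within d x c B" and "k \<ge> 1"
  shows "2 * (\<Sum>i = 1..<k. x i) + (real k - 1) * d \<le> (c - 1) * last_on_side x k + B"
proof -
  let ?l = "last_on_side x k"
  let ?A = "2 * (\<Sum>i = 1..<k. x i) + (real k - 1) * d"
  have bound: "?A \<le> (c - 1) * t + B" if t: "?l < t" "t \<le> x k" for t
  proof -
    have "t > 0" using t last_on_side_nonneg[OF x, of k] by simp
    define z where "z = (-1) ^ (k + 1) * t"
    have z: "\<bar>z\<bar> = t" "sgn z = (-1) ^ (k + 1)"
      using \<open>t > 0\<close> by (simp_all add: z_def abs_mult power_abs sgn_mult)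
    have "search_cost d x z \<le> ereal (c * \<bar>z\<bar> + B)"
      using f z \<open>t > 0\<close> unfolding finds_all_within_def by force
    then have "?A + t \<le> c * t + B"
      using search_cost_eq[OF x \<open>k \<ge> 1\<close> z(2), of d] t z(1) by simp
    then show ?thesis by (simp add: algebra_simps)
  qed
  \<comment> \<open>A target at distance exactly \<open>?l > 0\<close> is already found before turn
    \<open>k\<close>, so the bound at \<open>?l\<close> is only available as a limit from the
    right.\<close>
  have "((\<lambda>t. (c - 1) * t + B) \<longlongrightarrow> (c - 1) * ?l + B) (at_right ?l)"
    by (intro tendsto_intros)
  moreover have "\<forall>\<^sub>F t in at_right ?l. ?A \<le> (c - 1) * t + B"
    using last_on_side_less[OF x \<open>k \<ge> 1\<close>] bound
    by (auto simp: eventually_at_right_field intro!: exI[of _ "x k"])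
  ultimately show ?thesis
    by (intro tendsto_lowerbound) auto
qed

lemma additive_term_ge:
  fixes d :: real
  assumes "d > 0" and x: "search_strategy x" and f: "finds_all_within d x 9 B"
  shows "B \<ge> 2 * d"
proof -
  \<comment> \<open>The affine part \<open>a * n + b\<close> must satisfy
    \<open>a * n - 2 * a + b = (n + 1) * d / 2 - B / 2\<close>, whence \<open>a = d / 2\<close> and
    \<open>b = 3 * d / 2 - B / 2\<close>.\<close>
  define W where "W n = (\<Sum>i = 1..<n. x i) + real n * d / 2 + 3 * d / 2 - B / 2" for n
  define V where "V n = W n / 2 ^ n" for n
  have W: "W (n + 2) \<le> 4 * W (n + 1) - 4 * W n" for n
  \<comment> \<open>For \<open>n = 0\<close> the sums in \<open>W 0\<close> and \<open>W 1\<close>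
    are both empty; their difference \<open>0\<close> matches
    \<open>last_on_side x 2\<close>.\<close>
  proof (cases "n = 0")
    case True
    then show ?thesis
      using finds_all_within_turning_point_bound[OF x f, of 2]
      by (simp add: W_def last_on_side_def field_simps numeral_2_eq_2)
  next
    case False
    then have "(\<Sum>i = 1..<n + 1. x i) = (\<Sum>i = 1..<n. x i) + x n" by simp
    then show ?thesis
      using finds_all_within_turning_point_bound[OF x f, of "n + 2"] False
      by (simp add: W_def last_on_side_def field_simps)
  qed
  have "V (n + 2) - V (n + 1) \<le> V (n + 1) - V n" for n
  proof -
    have "(4 * W (n + 1) - 4 * W n - W (n + 2)) / 2 ^ (n + 2) \<ge> 0"
      using W[of n] by simp
    then show ?thesis by (simp add: V_def diff_divide_distrib)
  qed
  moreover obtain N where N: "B / d < real N"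
    using reals_Archimedean2 by blast
  have "V n \<ge> 0" if "n \<ge> N" for n
  proof -
    have "B / d \<le> real n" using N that by simp
    then have "B \<le> real n * d" using \<open>d > 0\<close> by (simp add: field_simps)
    moreover have "(\<Sum>i = 1..<n. x i) \<ge> 0"
      by (intro sum_nonneg) (simp add: search_strategy_pos[OF x] less_imp_le)
    ultimately have "W n \<ge> 0"
      using \<open>d > 0\<close> by (simp add: W_def)
    then show ?thesis by (simp add: V_def)
  qed
  ultimately have "V 0 \<le> V 1"
    by (rule concave_eventually_nonneg_imp_increment_nonneg)
  \<comment> \<open>Here \<open>V 0 = 3 * d / 2 - B / 2\<close> and
    \<open>V 1 = d - B / 4\<close>.\<close>
  then show ?thesis by (simp add: V_def W_def field_simps)
qed

lemma search_strategy_doubling: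
  fixes d :: real
  assumes "d > 0"
  shows "search_strategy (\<lambda>i. d * (2 ^ i - 1) / 2)"
  using assms by (auto simp: search_strategy_def)

lemma finds_all_within_doubling:
  fixes d :: real
  assumes "d > 0"
  shows "finds_all_within d (\<lambda>i. d * (2 ^ i - 1) / 2) 9 (2 * d)"
  unfolding finds_all_within_def
proof (intro allI impI)
  fix z :: real assume "z \<noteq> 0"
  let ?x = "\<lambda>i. d * (2 ^ i - 1) / 2"
  have x: "search_strategy ?x" using assms by (rule search_strategy_doubling)
  obtain n where n: "2 * \<bar>z\<bar> / d + 1 < 2 ^ n"
    using real_arch_pow[of 2 "2 * \<bar>z\<bar> / d + 1"] by auto
  \<comment> \<open>Odd turns lie on the right, so \<open>m\<close> is whichever of
    \<open>n + 1\<close> and \<open>n + 2\<close> has the parity of the side of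
    \<open>z\<close>.\<close>
  define m where "m = (if (odd n \<longleftrightarrow> z > 0) then n + 2 else n + 1)"
  have "(2::real) ^ n \<le> 2 ^ m" by (rule power_increasing) (simp_all add: m_def)
  with n have "2 * \<bar>z\<bar> / d + 1 < 2 ^ m" by linarith
  then have "\<bar>z\<bar> \<le> ?x m" using \<open>d > 0\<close> by (simp add: field_simps)
  moreover have "sgn z = (-1) ^ (m + 1)"
    using \<open>z \<noteq> 0\<close> by (auto simp: m_def sgn_if)
  moreover have "m \<ge> 1" by (simp add: m_def)
  ultimately have "reaches ?x z m" using reaches_iff[OF x] by blast
  define k where "k = (LEAST j. reaches ?x z j)"
  have reach: "reaches ?x z k"
    unfolding k_def by (rule LeastI) fact
  then have "k \<ge> 1" by (simp add: reaches_def)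
  have less: "last_on_side ?x k < \<bar>z\<bar>"
    using x \<open>z \<noteq> 0\<close> k_def reach by (rule last_on_side_less_if_Least_reaches)
  \<comment> \<open>Each \<open>2 * ?x i + d\<close> equals \<open>d * 2 ^ i\<close>, so turn costs
    and distances together form a geometric sum.\<close>
  have sum: "2 * (\<Sum>i = 1..<Suc j. ?x i) + real j * d = d * (2 ^ Suc j - 2)" for j
  proof (induction j)
    case (Suc j)
    have "(\<Sum>i = 1..<Suc (Suc j). ?x i) = (\<Sum>i = 1..<Suc j. ?x i) + ?x (Suc j)"
      by (rule sum.atLeastLessThan_Suc) simp
    moreover have "2 * ?x (Suc j) + d = d * 2 ^ Suc j"
      by (simp add: field_simps)
    moreover have "d * (2 ^ Suc (Suc j) - 2) = d * (2 ^ Suc j - 2) + d * 2 ^ Suc j"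
      by (simp add: algebra_simps)
    ultimately show ?case
      using Suc.IH by (simp only: of_nat_Suc distrib_left distrib_right)
  qed simp
  have "d * (2 ^ k - 4) \<le> 8 * \<bar>z\<bar>"
  proof (cases "k \<le> 2")
    case True
    then have "(2::real) ^ k \<le> 2 ^ 2" by (intro power_increasing) auto
    then have "d * (2 ^ k - 4) \<le> 0" using \<open>d > 0\<close> by (simp add: mult_nonneg_nonpos)
    then show ?thesis by linarith
  next
    case False
    then obtain j where "k = j + 2" by (metis add.commute le_add_diff_inverse nat_le_linear)
    then show ?thesis using less False by (simp add: last_on_side_def field_simps)
  qed
  moreover have "2 * (\<Sum>i = 1..<k. ?x i) + (real k - 1) * d = d * (2 ^ k - 2)"
    using sum[of "k - 1"] \<open>k \<ge> 1\<close> by (simp add: of_nat_diff)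
  \<comment> \<open>The additive term arises from
    \<open>d * (2 ^ k - 2) = d * (2 ^ k - 4) + 2 * d\<close>.\<close>
  ultimately have "2 * (\<Sum>i = 1..<k. ?x i) + (real k - 1) * d + \<bar>z\<bar> \<le> 9 * \<bar>z\<bar> + 2 * d"
    by (simp add: algebra_simps)
  moreover have "search_cost d ?x z = ereal (2 * (\<Sum>i = 1..<k. ?x i) + (real k - 1) * d + \<bar>z\<bar>)"
    using reach reaches_iff[OF x \<open>k \<ge> 1\<close>] less by (intro search_cost_eq[OF x \<open>k \<ge> 1\<close>]) auto
  ultimately show "search_cost d ?x z \<le> ereal (9 * \<bar>z\<bar> + 2 * d)"
    by (simp only: ereal_less_eq)
qed

theorem theorem6:
  fixes d :: real
  assumes "d > 0"
  shows "search_strategy (\<lambda>i. d * (2 ^ i - 1) / 2)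
    \<and> finds_all_within d (\<lambda>i. d * (2 ^ i - 1) / 2) 9 (2 * d)
    \<and> (\<forall>(B :: real) (x :: nat \<Rightarrow> real).
          search_strategy x \<and> finds_all_within d x 9 B \<longrightarrow> B \<ge> 2 * d)"
  using search_strategy_doubling[OF assms] finds_all_within_doubling[OF assms]
    additive_term_ge[OF assms] by blast

end
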